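(* Let $\mathcal H$ be a real Hilbert space and let $\Phi:\mathcal H\to\mathbb R$ be a continuously differentiable convex function such that the interior of $\operatorname{argmin}\Phi$ is nonempty. Let $t_0>0$, $\alpha>3$, and let $x:[t_0,+\infty[\to\mathcal H$ be a solution of $$\ddot x(t)+\frac{\alpha}{t}\dot x(t)+\nabla\Phi(x(t))=0 .$$ Then $x(t)$ converges strongly, as $t\to+\infty$, to a point in $\operatorname{argmin}\Phi$. Moreover, $$\int_{t_0}^{\infty}t\,\|\nabla\Phi(x(t))\|\,dt<+\infty .$$
   Context: A solution on $[t_0,+\infty[$ is a twice continuously differentiable function $x:[t_0,+\infty[\to\mathcal H$ satisfying the equation for all $t\ge t_0$. $\operatorname{argmin}\Phi$ denotes the set of global minimizers of $\Phi$; its interior is taken in the norm topology. Strong convergence means convergence in norm. *)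

theory Defs
  imports "HOL-Analysis.Analysis"
begin

definition argmin_set :: "('a \<Rightarrow> real) \<Rightarrow> 'a set" where
  "argmin_set \<Phi> = {z. \<forall>y. \<Phi> z \<le> \<Phi> y}"

text \<open>
  \<open>continuously_differentiable_with_gradient \<Phi> G\<close> says that \<open>\<Phi>\<close> is everywhere Frechet
  differentiable with gradient map \<open>G\<close> and that \<open>G\<close> is continuous for the norm. The gradient
  of the library, \<open>GDERIV\<close>, is the Riesz representative of the Frechet derivative.
\<close>

definition continuously_differentiable_with_gradient ::
    "('a::real_inner \<Rightarrow> real) \<Rightarrow> ('a \<Rightarrow> 'a) \<Rightarrow> bool" where
  "continuously_differentiable_with_gradient \<Phi> G \<longleftrightarrow>
     (\<forall>y. GDERIV \<Phi> y :> G y) \<and> continuous_on UNIV G"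

text \<open>
  Only the values of \<open>x\<close> on \<open>{t0..}\<close> matter; derivatives are taken within \<open>{t0..}\<close>, hence are
  one-sided at \<open>t0\<close>. The functions \<open>v\<close> and \<open>a\<close> are the first and second derivative of \<open>x\<close>.
\<close>

definition is_solution ::
    "real \<Rightarrow> real \<Rightarrow> ('a::real_normed_vector \<Rightarrow> 'a) \<Rightarrow> (real \<Rightarrow> 'a) \<Rightarrow> bool" where
  "is_solution t0 \<alpha> G x \<longleftrightarrow>
     (\<exists>v a. (\<forall>t\<ge>t0. (x has_vector_derivative v t) (at t within {t0..}))
          \<and> (\<forall>t\<ge>t0. (v has_vector_derivative a t) (at t within {t0..}))
          \<and> continuous_on {t0..} a
          \<and> (\<forall>t\<ge>t0. a t + (\<alpha> / t) *\<^sub>R v t + G (x t) = 0))"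

end

(*
  Fix a ball of radius r around z inside argmin \<Phi>. Convexity, tested at the point
  z + r grad/|grad| of the ball, gives r |grad \<Phi>(p)| <= <grad \<Phi>(p), p - z> for all p. Hence the energy
    E(t) = t^2 (\<Phi>(x) - min \<Phi>) + |(\<alpha> - 1)(x - z) + t x'|^2 / 2
  satisfies E' <= -(\<alpha> - 3) r t |grad \<Phi>(x)|, so t |grad \<Phi>(x)| is integrable. As
  w = x + t x' / (\<alpha> - 1) has derivative -t grad \<Phi>(x) / (\<alpha> - 1), w converges in norm, and so does x.
  The limit is a minimizer since \<Phi>(x) - min \<Phi> <= E(t0) / t^2.
*)

theory Submission
  imports Defs
begin

section \<open>Convexity and balls of minimizers\<close>

lemma convex_on_gradient_inequality:
  fixes \<Phi> :: "'a::real_inner \<Rightarrow> real"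
  assumes conv: "convex_on UNIV \<Phi>"
    and grad: "GDERIV \<Phi> p :> g"
  shows "\<Phi> p + inner g (q - p) \<le> \<Phi> q"
proof -
  \<comment> \<open>On the line through \<open>p\<close> and \<open>q\<close> the claim becomes the
    tangent inequality at 0 for a convex function of one real variable.\<close>
  define f where "f = (\<lambda>s::real. \<Phi> (p + s *\<^sub>R (q - p)))"
  have "convex_on UNIV f"
  proof (rule convex_onI)
    fix t r s :: real assume "0 < t" "t < 1"
    have "p + ((1 - t) *\<^sub>R r + t *\<^sub>R s) *\<^sub>R (q - p)
        = (1 - t) *\<^sub>R (p + r *\<^sub>R (q - p)) + t *\<^sub>R (p + s *\<^sub>R (q - p))"
      by (simp add: algebra_simps)
    then show "f ((1 - t) *\<^sub>R r + t *\<^sub>R s) \<le> (1 - t) * f r + t * f s"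
      unfolding f_def using convex_onD[OF conv, of t] \<open>0 < t\<close> \<open>t < 1\<close> by simp
  qed simp
  moreover have "(f has_field_derivative inner g (q - p)) (at 0 within UNIV)"
  proof -
    have "((\<lambda>s::real. p + s *\<^sub>R (q - p)) has_derivative (\<lambda>h. h *\<^sub>R (q - p))) (at 0)"
      by (auto intro!: derivative_eq_intros)
    moreover have "(\<Phi> has_derivative (\<lambda>h. inner h g)) (at (p + 0 *\<^sub>R (q - p)))"
      using grad by (simp add: gderiv_def)
    ultimately have "(f has_derivative (\<lambda>h. inner (h *\<^sub>R (q - p)) g)) (at 0)"
      unfolding f_def by (rule has_derivative_compose)
    then show ?thesis
      by (simp add: has_field_derivative_def inner_commute mult_commute_abs)
  qed
  ultimately have "f 1 - f 0 \<ge> inner g (q - p) * (1 - 0)"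
    by (intro convex_on_imp_above_tangent[of UNIV]) auto
  then show ?thesis by (simp add: f_def)
qed

text \<open>The tangent at \<open>p\<close> lies below \<open>\<Phi>\<close>, so \<open>g\<close>
  cannot point from \<open>p\<close> towards a minimizer; applying this to the minimizer farthest
  from \<open>z\<close> in direction \<open>g\<close> gains the term \<open>r * norm g\<close>. For
  \<open>r > 0\<close> this makes the inner product control the norm of the gradient.\<close>

lemma norm_gradient_le_inner_argmin_ball:
  fixes \<Phi> :: "'a::real_inner \<Rightarrow> real"
  assumes conv: "convex_on UNIV \<Phi>" and grad: "GDERIV \<Phi> p :> g"
    and r: "0 \<le> r" and ball: "cball z r \<subseteq> argmin_set \<Phi>"
  shows "r * norm g \<le> inner g (p - z)"
proof -
  \<comment> \<open>Since \<open>sgn 0 = 0\<close>, the point \<open>q\<close> lies in the ball also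
    when \<open>g\<close> vanishes.\<close>
  define q where "q = z + r *\<^sub>R sgn g"
  have "norm (r *\<^sub>R sgn g) \<le> r"
    using r by (simp add: norm_sgn)
  then have "q \<in> argmin_set \<Phi>"
    using ball by (auto simp: q_def dist_norm)
  then have "\<Phi> q \<le> \<Phi> p" by (simp add: argmin_set_def)
  with convex_on_gradient_inequality[OF conv grad, of q]
  have "inner g (q - p) \<le> 0" by simp
  moreover have "inner g (sgn g) = norm g"
    by (cases "g = 0") (simp_all add: sgn_div_norm dot_square_norm power2_eq_square)
  ultimately show ?thesis
    by (simp add: q_def inner_diff_right inner_add_right)
qed

section \<open>Limits at infinity\<close>

text \<open>The bound makes \<open>e\<close> nonincreasing, and \<open>e\<close> is bounded below,
  so its remaining decrease tends to 0; this decrease dominates the increments of \<open>w\<close>.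
  With an energy as \<open>e\<close>, no vector-valued integral is needed.\<close>

lemma convergent_at_top_if_increments_bounded:
  fixes w :: "real \<Rightarrow> 'a::complete_space" and e :: "real \<Rightarrow> real"
  assumes incr: "\<And>s t. a \<le> s \<Longrightarrow> s \<le> t \<Longrightarrow> dist (w t) (w s) \<le> e s - e t"
    and nonneg: "\<And>t. a \<le> t \<Longrightarrow> 0 \<le> e t"
  shows "\<exists>l. (w \<longlongrightarrow> l) at_top"
proof -
  \<comment> \<open>\<open>T\<close> is chosen so that \<open>e T\<close> is within
    \<open>\<epsilon>\<close> of the infimum of \<open>e\<close>; from then on \<open>e\<close> can
    drop by less than \<open>\<epsilon>\<close>.\<close>
  have tail: "\<exists>T\<ge>a. \<forall>t\<ge>T. dist (w t) (w T) < \<epsilon>" if "0 < \<epsilon>" for \<epsilon>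
  proof -
    have bdd: "bdd_below (e ` {a..})"
      using nonneg by (auto intro!: bdd_belowI[of _ 0])
    have "Inf (e ` {a..}) < Inf (e ` {a..}) + \<epsilon>" using that by simp
    then have "\<exists>y\<in>e ` {a..}. y < Inf (e ` {a..}) + \<epsilon>"
      by (intro cInf_lessD) auto
    then obtain T where T: "T \<ge> a" "e T < Inf (e ` {a..}) + \<epsilon>"
      by auto
    have "dist (w t) (w T) < \<epsilon>" if "t \<ge> T" for t
    proof -
      have "Inf (e ` {a..}) \<le> e t" using T that by (intro cInf_lower bdd) auto
      then show ?thesis using incr[of T t] T that by linarith
    qed
    with T show ?thesis by blast
  qed
  \<comment> \<open>Completeness is applied to the values at integers; \<open>tail\<close> then
    extends the limit to all real times.\<close>
  have "Cauchy (\<lambda>n. w (real n))"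
  proof (rule metric_CauchyI)
    fix \<epsilon> :: real assume "0 < \<epsilon>"
    then obtain T where T: "\<And>t. t \<ge> T \<Longrightarrow> dist (w t) (w T) < \<epsilon> / 2"
      using tail[of "\<epsilon> / 2"] by auto
    obtain N :: nat where "T \<le> real N" using real_arch_simple by blast
    then have "dist (w (real m)) (w (real n)) < \<epsilon>" if "m \<ge> N" "n \<ge> N" for m n
      using that by (intro dist_triangle_half_l[OF T T]) auto
    then show "\<exists>N. \<forall>m\<ge>N. \<forall>n\<ge>N. dist (w (real m)) (w (real n)) < \<epsilon>" by blast
  qed
  then obtain l where l: "(\<lambda>n. w (real n)) \<longlonglongrightarrow> l"
    using Cauchy_convergent convergent_def by blast
  have "(w \<longlongrightarrow> l) at_top"
  proof (rule tendstoI)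
    fix \<epsilon> :: real assume "0 < \<epsilon>"
    then obtain T where T: "\<And>t. t \<ge> T \<Longrightarrow> dist (w t) (w T) < \<epsilon> / 2"
      using tail[of "\<epsilon> / 2"] by auto
    obtain N :: nat where N: "T \<le> real N" using real_arch_simple by blast
    have "(\<lambda>n. dist (w (real n)) (w T)) \<longlonglongrightarrow> dist l (w T)"
      by (intro tendsto_intros l)
    moreover have "dist (w (real n)) (w T) \<le> \<epsilon> / 2" if "n \<ge> N" for n
      using T[of "real n"] that N by simp
    ultimately have "dist l (w T) \<le> \<epsilon> / 2"
      by (blast intro: LIMSEQ_le_const2)
    then have "dist (w t) l < \<epsilon>" if "t \<ge> T" for t
      using T[OF that] dist_triangle[of "w t" l "w T"] by (simp add: dist_commute)
    then show "\<forall>\<^sub>F t in at_top. dist (w t) l < \<epsilon>"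
      by (auto simp: eventually_at_top_linorder)
  qed
  then show ?thesis ..
qed

text \<open>
  \<open>t powr \<beta>\<close> is an integrating factor:
  \<open>(t powr \<beta> *\<^sub>R x)' = (\<beta> * t powr (\<beta> - 1)) *\<^sub>R (x + (t / \<beta>) *\<^sub>R x')\<close>.
\<close>

lemma tendsto_if_tendsto_add_scaled_derivative:
  fixes x v :: "real \<Rightarrow> 'a::real_normed_vector"
  assumes \<beta>: "0 < \<beta>"
    and der: "\<And>t. t > a \<Longrightarrow> (x has_vector_derivative v t) (at t)"
    and lim: "((\<lambda>t. x t + (t / \<beta>) *\<^sub>R v t) \<longlongrightarrow> l) at_top"
  shows "(x \<longlongrightarrow> l) at_top"
proof (rule tendstoI)
  fix \<epsilon> :: real assume \<epsilon>: "0 < \<epsilon>"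
  have "\<forall>\<^sub>F t in at_top. dist (x t + (t / \<beta>) *\<^sub>R v t) l < \<epsilon> / 2"
    using tendstoD[OF lim, of "\<epsilon> / 2"] \<epsilon> by simp
  then obtain T0 where T0: "\<And>t. t \<ge> T0 \<Longrightarrow> dist (x t + (t / \<beta>) *\<^sub>R v t) l < \<epsilon> / 2"
    by (auto simp: eventually_at_top_linorder)
  define T where "T = max 1 (max T0 (a + 1))"
  have T: "T > 0" "T \<ge> T0" "T > a" by (auto simp: T_def)
  \<comment> \<open>The derivative \<open>y'\<close> is
    \<open>\<beta> * t powr (\<beta> - 1)\<close> times a vector already known to have norm below
    \<open>\<epsilon> / 2\<close>, so \<open>y\<close> grows no faster than
    \<open>\<epsilon> / 2 * t powr \<beta>\<close>.\<close>
  define y where "y = (\<lambda>t. (t powr \<beta>) *\<^sub>R (x t - l))"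
  define y' where "y' = (\<lambda>t. (\<beta> * t powr (\<beta> - 1)) *\<^sub>R (x t + (t / \<beta>) *\<^sub>R v t - l))"
  have y_der: "(y has_vector_derivative y' t) (at t)" if "t \<ge> T" for t
  proof -
    have t: "t > 0" "t > a" using that T by auto
    have "((\<lambda>t. t powr \<beta>) has_real_derivative \<beta> * t powr (\<beta> - 1)) (at t)"
      using t(1) by (rule has_real_derivative_powr)
    then have "(y has_vector_derivative
        (t powr \<beta>) *\<^sub>R (v t - 0) + (\<beta> * t powr (\<beta> - 1)) *\<^sub>R (x t - l)) (at t)"
      unfolding y_def
      by (intro has_vector_derivative_scaleR has_vector_derivative_diff
          has_vector_derivative_const der t)
    moreover have "t powr \<beta> = t powr (\<beta> - 1) * t"
      using t by (simp add: powr_diff)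
    ultimately show ?thesis
      using \<beta> by (simp add: y'_def algebra_simps)
  qed
  have phi_der: "((\<lambda>t. \<epsilon> / 2 * t powr \<beta>) has_vector_derivative \<epsilon> / 2 * (\<beta> * t powr (\<beta> - 1))) (at t)"
    if "t \<ge> T" for t
    unfolding has_real_derivative_iff_has_vector_derivative[symmetric]
    using that T by (intro DERIV_cmult has_real_derivative_powr) auto
  have bound: "norm (y' t) \<le> \<epsilon> / 2 * (\<beta> * t powr (\<beta> - 1))" if "t \<ge> T" for t
  proof -
    have "norm (x t + (t / \<beta>) *\<^sub>R v t - l) \<le> \<epsilon> / 2"
      using T0[of t] that T by (simp add: dist_norm)
    then have "norm (y' t) \<le> (\<beta> * t powr (\<beta> - 1)) * (\<epsilon> / 2)"
      unfolding y'_def using \<beta> by (simp add: abs_mult mult_left_mono)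
    then show ?thesis by (simp only: mult.commute)
  qed
  have growth: "norm (y t - y T) \<le> \<epsilon> / 2 * t powr \<beta> - \<epsilon> / 2 * T powr \<beta>" if "t > T" for t
  proof (rule differentiable_bound_general[OF that, where f' = y'
        and \<phi>' = "\<lambda>t. \<epsilon> / 2 * (\<beta> * t powr (\<beta> - 1))"])
    show "continuous_on {T..t} y"
      by (intro continuous_at_imp_continuous_on ballI)
        (auto intro: has_vector_derivative_continuous[OF y_der])
    show "continuous_on {T..t} (\<lambda>t. \<epsilon> / 2 * t powr \<beta>)"
      by (intro continuous_at_imp_continuous_on ballI
          has_vector_derivative_continuous[OF phi_der]) simp
  qed (simp_all only: y_der phi_der bound less_imp_le)
  have "filterlim (\<lambda>t::real. t powr \<beta>) at_top at_top"
    using \<beta> by (rule real_powr_at_top)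
  \<comment> \<open>Past this threshold the starting value \<open>norm (y T)\<close> costs at most
    another \<open>\<epsilon> / 2\<close> after division by the weight.\<close>
  then have "\<forall>\<^sub>F t in at_top. 2 * norm (y T) / \<epsilon> < t powr \<beta>"
    by (simp add: filterlim_at_top_dense)
  moreover have "\<forall>\<^sub>F t in at_top. t > T" by (rule eventually_gt_at_top)
  ultimately show "\<forall>\<^sub>F t in at_top. dist (x t) l < \<epsilon>"
  proof eventually_elim
    case (elim t)
    have "norm (y t) \<le> norm (y t - y T) + norm (y T)"
      by (metis diff_add_cancel norm_triangle_ineq)
    also have "\<dots> \<le> \<epsilon> / 2 * t powr \<beta> - \<epsilon> / 2 * T powr \<beta> + norm (y T)"
      using growth elim by simp
    also have "\<dots> \<le> \<epsilon> / 2 * t powr \<beta> + norm (y T)"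
      using \<epsilon> by simp
    also have "norm (y T) < \<epsilon> / 2 * t powr \<beta>"
      using elim(1) \<epsilon> by (simp add: field_simps)
    finally have "t powr \<beta> * norm (x t - l) < t powr \<beta> * \<epsilon>"
      by (simp add: y_def mult.commute)
    moreover have "0 < t powr \<beta>" using elim(2) T by simp
    ultimately show ?case by (simp add: dist_norm)
  qed
qed

section \<open>Integrability from a decreasing function\<close>

text \<open>On \<open>{a..a + n}\<close> the fundamental theorem bounds the integral by
  \<open>F a - F (a + n)\<close>, hence by \<open>F a\<close> uniformly in \<open>n\<close>;
  monotone convergence removes the truncation.\<close>

lemma nn_integral_atLeast_le_if_le_minus_derivative:
  fixes f F F' :: "real \<Rightarrow> real"
  assumes cont: "continuous_on {a..} f"
    and f_nonneg: "\<And>t. a \<le> t \<Longrightarrow> 0 \<le> f t"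
    and der: "\<And>t. a \<le> t \<Longrightarrow> (F has_vector_derivative F' t) (at t within {a..})"
    and le: "\<And>t. a \<le> t \<Longrightarrow> f t \<le> - F' t"
    and F_nonneg: "\<And>t. a \<le> t \<Longrightarrow> 0 \<le> F t"
  shows "(\<integral>\<^sup>+ t\<in>{a..}. ennreal (f t) \<partial>lborel) \<le> ennreal (F a)"
proof -
  define g where "g = (\<lambda>n t. ennreal (f t) * indicator {a..a + real n} t)"
  \<comment> \<open>Nothing is known about \<open>f\<close> to the left of \<open>a\<close>, so
    measurability is proved only for \<open>f\<close> cut off by the indicator.\<close>
  have meas: "g n \<in> borel_measurable lborel" for n
  proof -
    have "continuous_on {a..a + real n} f"
      by (rule continuous_on_subset[OF cont]) auto
    then have "set_borel_measurable borel {a..a + real n} f"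
      by (intro borel_measurable_continuous_on_indicator[folded set_borel_measurable_def]) auto
    then have [measurable]: "(\<lambda>t. indicator {a..a + real n} t *\<^sub>R f t) \<in> borel_measurable borel"
      by (simp add: set_borel_measurable_def)
    have "g n = (\<lambda>t. ennreal (indicator {a..a + real n} t *\<^sub>R f t))"
      by (auto simp: g_def indicator_def)
    then show ?thesis
      by (simp only:) measurable
  qed
  have bound: "integral\<^sup>N lborel (g n) \<le> ennreal (F a)" for n
  proof -
    let ?b = "a + real n"
    have "f integrable_on {a..?b}"
      by (intro integrable_continuous_interval continuous_on_subset[OF cont]) auto
    then obtain I where I: "(f has_integral I) {a..?b}" by blast
    have "(F' has_integral (F ?b - F a)) {a..?b}"
      by (intro fundamental_theorem_of_calculus
          has_vector_derivative_within_subset[OF der]) auto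
    then have "((\<lambda>t. - F' t) has_integral - (F ?b - F a)) {a..?b}"
      by (rule has_integral_neg)
    then have "I \<le> - (F ?b - F a)"
      by (rule has_integral_le[OF I]) (use le in auto)
    also have "\<dots> \<le> F a" using F_nonneg[of ?b] by simp
    finally have "I \<le> F a" .
    moreover have "integral\<^sup>N lborel (g n) = ennreal I"
      unfolding g_def by (rule nn_integral_has_integral_lebesgue'[OF _ I]) (use f_nonneg in auto)
    ultimately show ?thesis by (simp add: ennreal_leI)
  qed
  have inc: "incseq g"
    by (auto simp: incseq_def le_fun_def g_def indicator_def)
  have "(SUP n. g n t) = ennreal (f t) * indicator {a..} t" for t
  proof (cases "a \<le> t")
    case True
    obtain n :: nat where "t - a \<le> real n" using real_arch_simple by blast
    with True have "g n t = ennreal (f t)" by (simp add: g_def)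
    moreover have "g m t \<le> ennreal (f t)" for m by (simp add: g_def indicator_def)
    ultimately have "(SUP n. g n t) = ennreal (f t)"
      by (intro antisym SUP_least SUP_upper2[of n]) auto
    with True show ?thesis by simp
  qed (simp add: g_def)
  then have "(\<integral>\<^sup>+ t\<in>{a..}. ennreal (f t) \<partial>lborel) = (\<integral>\<^sup>+ t. (SUP n. g n t) \<partial>lborel)"
    by simp
  also have "\<dots> = (SUP n. integral\<^sup>N lborel (g n))"
    by (rule nn_integral_monotone_convergence_SUP[OF inc meas])
  also have "\<dots> \<le> ennreal (F a)" by (intro SUP_least bound)
  finally show ?thesis .
qed

theorem theorem3p1:
  fixes \<Phi> :: "'a :: {real_inner, complete_space} \<Rightarrow> real"
    and grad\<Phi> :: "'a \<Rightarrow> 'a"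
    and t0 \<alpha> :: real
    and x :: "real \<Rightarrow> 'a"
  assumes "continuously_differentiable_with_gradient \<Phi> grad\<Phi>"
    and "convex_on UNIV \<Phi>"
    and "interior (argmin_set \<Phi>) \<noteq> {}"
    and "t0 > 0"
    and "\<alpha> > 3"
    and "is_solution t0 \<alpha> grad\<Phi> x"
  shows "(\<exists>z \<in> argmin_set \<Phi>. (x \<longlongrightarrow> z) at_top) \<and>
         (\<integral>\<^sup>+ t\<in>{t0..}. ennreal (t * norm (grad\<Phi> (x t))) \<partial>lborel) < \<infinity>"
proof -
  let ?G = "\<lambda>t. grad\<Phi> (x t)"
  have grad: "\<And>y. GDERIV \<Phi> y :> grad\<Phi> y"
    and grad_cont: "continuous_on UNIV grad\<Phi>"
    using assms(1) by (auto simp: continuously_differentiable_with_gradient_def)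
  note conv = assms(2) and t0 = assms(4) and \<alpha> = assms(5)
  obtain v a where x_der: "\<And>t. t \<ge> t0 \<Longrightarrow> (x has_vector_derivative v t) (at t within {t0..})"
    and v_der: "\<And>t. t \<ge> t0 \<Longrightarrow> (v has_vector_derivative a t) (at t within {t0..})"
    and ode: "\<And>t. t \<ge> t0 \<Longrightarrow> a t + (\<alpha> / t) *\<^sub>R v t + ?G t = 0"
    using assms(6) unfolding is_solution_def by blast
  obtain z r where r: "r > 0" and ball: "cball z r \<subseteq> argmin_set \<Phi>"
    using assms(3) by (auto simp: mem_interior_cball ex_in_conv[symmetric])
  have "z \<in> argmin_set \<Phi>" using ball r by auto
  then have z_min: "\<Phi> z \<le> \<Phi> y" for y by (simp add: argmin_set_def)

  \<comment> \<open>The energy and its dissipation\<close>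
  have ta: "t *\<^sub>R a t = - \<alpha> *\<^sub>R v t - t *\<^sub>R ?G t" if "t \<ge> t0" for t
  proof -
    have "t *\<^sub>R (a t + (\<alpha> / t) *\<^sub>R v t + ?G t) = 0" using ode[OF that] by simp
    then have "t *\<^sub>R a t + \<alpha> *\<^sub>R v t + t *\<^sub>R ?G t = 0"
      using that t0 by (simp add: scaleR_add_right)
    then show ?thesis by (simp add: algebra_simps eq_neg_iff_add_eq_0)
  qed

  define E where "E = (\<lambda>t. t\<^sup>2 * (\<Phi> (x t) - \<Phi> z)
      + inner ((\<alpha> - 1) *\<^sub>R (x t - z) + t *\<^sub>R v t) ((\<alpha> - 1) *\<^sub>R (x t - z) + t *\<^sub>R v t) / 2)"
  define E' where "E' = (\<lambda>t. 2 * t * (\<Phi> (x t) - \<Phi> z) - (\<alpha> - 1) * t * inner (?G t) (x t - z))"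
  define c where "c = (\<alpha> - 3) * r"
  have c: "c > 0" using r \<alpha> by (simp add: c_def)
  have E_ge: "t\<^sup>2 * (\<Phi> (x t) - \<Phi> z) \<le> E t" for t by (simp add: E_def)
  have E_nonneg: "0 \<le> E t" for t
    using z_min by (simp add: E_def)
  have E_der: "(E has_vector_derivative E' t) (at t within {t0..})" if t: "t \<ge> t0" for t
  proof -
    let ?u = "\<lambda>t. (\<alpha> - 1) *\<^sub>R (x t - z) + t *\<^sub>R v t"
    have \<Phi>_der: "((\<lambda>t. \<Phi> (x t)) has_real_derivative inner (v t) (?G t)) (at t within {t0..})"
    proof -
      have "((\<lambda>t. \<Phi> (x t)) has_derivative (\<lambda>h. inner (h *\<^sub>R v t) (?G t))) (at t within {t0..})"
        using x_der[OF t] grad[of "x t"] unfolding has_vector_derivative_def gderiv_def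
        by (rule has_derivative_compose)
      then show ?thesis by (simp add: has_field_derivative_def mult_commute_abs)
    qed
    have "(?u has_vector_derivative
        (\<alpha> - 1) *\<^sub>R (v t - 0) + (t *\<^sub>R a t + 1 *\<^sub>R v t)) (at t within {t0..})"
      by (intro has_vector_derivative_add has_vector_derivative_diff has_vector_derivative_const
          bounded_linear.has_vector_derivative[OF bounded_linear_scaleR_right]
          has_vector_derivative_scaleR DERIV_ident x_der v_der t)
    \<comment> \<open>The weight \<open>\<alpha> - 1\<close> is chosen for this: the velocity terms
      add up to \<open>\<alpha> *\<^sub>R v t\<close>, which the friction term in \<open>ta\<close>
      cancels.\<close>
    then have u_der: "(?u has_vector_derivative - t *\<^sub>R ?G t) (at t within {t0..})"
      using ta[OF t] by (simp add: algebra_simps)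
    have "((\<lambda>t. inner (?u t) (?u t)) has_real_derivative
        inner (?u t) (- t *\<^sub>R ?G t) + inner (- t *\<^sub>R ?G t) (?u t)) (at t within {t0..})"
      unfolding has_real_derivative_iff_has_vector_derivative
      by (intro bounded_bilinear.has_vector_derivative[OF bounded_bilinear_inner] u_der)
    then have "(E has_real_derivative
        (2 * t * (\<Phi> (x t) - \<Phi> z) + t\<^sup>2 * inner (v t) (?G t))
        + (inner (?u t) (- t *\<^sub>R ?G t) + inner (- t *\<^sub>R ?G t) (?u t)) / 2) (at t within {t0..})"
      unfolding E_def by (auto intro!: derivative_eq_intros \<Phi>_der)
    \<comment> \<open>The terms with \<open>inner (v t) (?G t)\<close> from the potential and from
      the squared norm cancel, so \<open>E'\<close> contains no velocity.\<close>
    moreover have "(2 * t * (\<Phi> (x t) - \<Phi> z) + t\<^sup>2 * inner (v t) (?G t))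
        + (inner (?u t) (- t *\<^sub>R ?G t) + inner (- t *\<^sub>R ?G t) (?u t)) / 2 = E' t"
    proof -
      have "(inner (?u t) (- t *\<^sub>R ?G t) + inner (- t *\<^sub>R ?G t) (?u t)) / 2 = - t * inner (?G t) (?u t)"
        by (simp add: inner_commute[of "?u t"])
      also have "\<dots> = - (\<alpha> - 1) * t * inner (?G t) (x t - z) - t\<^sup>2 * inner (v t) (?G t)"
        by (simp add: inner_add_right inner_commute[of "v t"] power2_eq_square algebra_simps)
      finally show ?thesis
        unfolding E'_def by (simp only:)
    qed
    ultimately show ?thesis
      by (simp add: has_real_derivative_iff_has_vector_derivative)
  qed
  \<comment> \<open>Split \<open>\<alpha> - 1\<close> as \<open>2 + (\<alpha> - 3)\<close>: two
    copies of the inner product absorb the value gap by convexity, and the ball estimate turns the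
    other \<open>\<alpha> - 3\<close> into the gradient norm.\<close>
  have E'_le: "c * (t * norm (?G t)) \<le> - E' t" if t: "t \<ge> t0" for t
  proof -
    have "\<Phi> (x t) - \<Phi> z \<le> inner (?G t) (x t - z)"
      using convex_on_gradient_inequality[OF conv grad, of "x t" z]
      by (simp add: inner_diff_right)
    then have "2 * t * (\<Phi> (x t) - \<Phi> z) \<le> 2 * t * inner (?G t) (x t - z)"
      using t t0 by (intro mult_left_mono) auto
    moreover have "(\<alpha> - 3) * t * (r * norm (?G t)) \<le> (\<alpha> - 3) * t * inner (?G t) (x t - z)"
      using t t0 \<alpha> r
      by (intro mult_left_mono norm_gradient_le_inner_argmin_ball[OF conv grad _ ball]) auto
    ultimately show ?thesis by (simp add: E'_def c_def algebra_simps)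
  qed

  have x_cont: "continuous_on {t0..} x"
    unfolding continuous_on_eq_continuous_within
    by (auto intro: has_vector_derivative_continuous x_der)
  have E_cont: "continuous_on {t0..} E"
    unfolding continuous_on_eq_continuous_within
    by (auto intro: has_vector_derivative_continuous E_der)
  have G_cont: "continuous_on {t0..} ?G"
    by (rule continuous_on_compose2[OF grad_cont x_cont]) simp

  \<comment> \<open>Integrability of the weighted gradient norm\<close>
  have "(\<integral>\<^sup>+ t\<in>{t0..}. ennreal (t * norm (?G t)) \<partial>lborel) \<le> ennreal (E t0 / c)"
  proof (rule nn_integral_atLeast_le_if_le_minus_derivative)
    show "continuous_on {t0..} (\<lambda>t. t * norm (?G t))"
      by (intro continuous_intros G_cont)
    show "((\<lambda>t. E t / c) has_vector_derivative E' t / c) (at t within {t0..})" if "t0 \<le> t" for t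
      using E_der[OF that] unfolding has_real_derivative_iff_has_vector_derivative[symmetric]
      by (rule DERIV_cdivide)
    show "t * norm (?G t) \<le> - (E' t / c)" if "t0 \<le> t" for t
      using E'_le[OF that] c by (simp add: field_simps)
  qed (use t0 c E_nonneg in auto)
  then have integral: "(\<integral>\<^sup>+ t\<in>{t0..}. ennreal (t * norm (?G t)) \<partial>lborel) < \<infinity>"
    by (rule order_le_less_trans) simp

  \<comment> \<open>Strong convergence of the trajectory\<close>
  define w where "w = (\<lambda>t. x t + (t / (\<alpha> - 1)) *\<^sub>R v t)"
  \<comment> \<open>The vector squared in \<open>E\<close> is
    \<open>(\<alpha> - 1) *\<^sub>R (w t - z)\<close>, so the same cancellation leaves only the
    gradient.\<close>
  have w_der: "(w has_vector_derivative - (t / (\<alpha> - 1)) *\<^sub>R ?G t) (at t within {t0..})"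
    if t: "t \<ge> t0" for t
  proof -
    have "((\<lambda>t. t / (\<alpha> - 1)) has_real_derivative 1 / (\<alpha> - 1)) (at t within {t0..})"
      by (intro DERIV_cdivide DERIV_ident)
    then have "(w has_vector_derivative
        v t + ((t / (\<alpha> - 1)) *\<^sub>R a t + (1 / (\<alpha> - 1)) *\<^sub>R v t)) (at t within {t0..})"
      unfolding w_def
      by (intro has_vector_derivative_add has_vector_derivative_scaleR x_der v_der t)
    moreover have "v t + ((t / (\<alpha> - 1)) *\<^sub>R a t + (1 / (\<alpha> - 1)) *\<^sub>R v t)
        = - (t / (\<alpha> - 1)) *\<^sub>R ?G t"
    proof -
      have "(t / (\<alpha> - 1)) *\<^sub>R a t = (1 / (\<alpha> - 1)) *\<^sub>R (t *\<^sub>R a t)" by simp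
      also have "\<dots> = (1 / (\<alpha> - 1)) *\<^sub>R (- \<alpha> *\<^sub>R v t - t *\<^sub>R ?G t)" by (simp only: ta[OF t])
      also have "\<dots> = - (\<alpha> / (\<alpha> - 1)) *\<^sub>R v t - (t / (\<alpha> - 1)) *\<^sub>R ?G t"
        by (simp add: scaleR_diff_right)
      finally have "v t + ((t / (\<alpha> - 1)) *\<^sub>R a t + (1 / (\<alpha> - 1)) *\<^sub>R v t)
          = (1 - \<alpha> / (\<alpha> - 1) + 1 / (\<alpha> - 1)) *\<^sub>R v t - (t / (\<alpha> - 1)) *\<^sub>R ?G t"
        by (simp add: scaleR_add_left scaleR_diff_left)
      also have "1 - \<alpha> / (\<alpha> - 1) + 1 / (\<alpha> - 1) = 0"
        using \<alpha> by (simp add: field_simps)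
      finally show ?thesis by simp
    qed
    ultimately show ?thesis by simp
  qed
  have w_cont: "continuous_on {t0..} w"
    unfolding continuous_on_eq_continuous_within
    by (auto intro: has_vector_derivative_continuous w_der)
  \<comment> \<open>The factor \<open>\<alpha> - 1\<close> comes from the derivative of
    \<open>w\<close> and \<open>c\<close> from \<open>E'_le\<close>; thus the speed of
    \<open>w\<close> is at most \<open>- E' t / k\<close>.\<close>
  define k where "k = c * (\<alpha> - 1)"
  have k: "k > 0" using c \<alpha> by (simp add: k_def)
  \<comment> \<open>The mean value inequality and the lemma applied to \<open>x\<close> ask for
    two-sided derivatives, available after \<open>t0\<close>.\<close>
  have at_eq: "at t within {t0..} = at t" if "t > t0" for t
    using that by (intro at_within_interior) auto
  have w_incr: "dist (w t) (w s) \<le> E s / k - E t / k" if "t0 \<le> s" "s \<le> t" for s t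
  \<comment> \<open>The mean value inequality below needs a nondegenerate interval.\<close>
  proof (cases "s = t")
    case False
    have "norm (w t - w s) \<le> - E t / k - - E s / k"
    proof (rule differentiable_bound_general[where f = w
          and f' = "\<lambda>t. - (t / (\<alpha> - 1)) *\<^sub>R ?G t"
          and \<phi> = "\<lambda>t. - E t / k" and \<phi>' = "\<lambda>t. - E' t / k"])
      show "s < t" using False that by simp
      show "continuous_on {s..t} w" "continuous_on {s..t} (\<lambda>t. - E t / k)"
        using that k by (auto intro!: continuous_intros continuous_on_subset[OF w_cont]
            continuous_on_subset[OF E_cont])
      fix \<tau> assume "s < \<tau>" "\<tau> < t"
      then have \<tau>: "t0 < \<tau>" "t0 \<le> \<tau>" using that by auto
      show "(w has_vector_derivative - (\<tau> / (\<alpha> - 1)) *\<^sub>R ?G \<tau>) (at \<tau>)"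
        using w_der[OF \<tau>(2)] at_eq[OF \<tau>(1)] by simp
      show "((\<lambda>t. - E t / k) has_vector_derivative - E' \<tau> / k) (at \<tau>)"
        using E_der[OF \<tau>(2)] at_eq[OF \<tau>(1)]
        unfolding has_real_derivative_iff_has_vector_derivative[symmetric]
        by (intro DERIV_cdivide DERIV_minus) simp
      have "norm (- (\<tau> / (\<alpha> - 1)) *\<^sub>R ?G \<tau>) = c * (\<tau> * norm (?G \<tau>)) / k"
        using c \<alpha> \<tau> t0 by (simp add: k_def)
      also have "\<dots> \<le> - E' \<tau> / k"
        using E'_le[OF \<tau>(2)] k by (intro divide_right_mono) auto
      finally show "norm (- (\<tau> / (\<alpha> - 1)) *\<^sub>R ?G \<tau>) \<le> - E' \<tau> / k" .
    qed
    then show ?thesis by (simp add: dist_norm)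
  qed simp
  have "\<exists>l. (w \<longlongrightarrow> l) at_top"
    by (rule convergent_at_top_if_increments_bounded[OF w_incr]) (use E_nonneg k in auto)
  then obtain l where w_lim: "(w \<longlongrightarrow> l) at_top" ..
  have x_lim: "(x \<longlongrightarrow> l) at_top"
  proof (rule tendsto_if_tendsto_add_scaled_derivative)
    show "0 < \<alpha> - 1" using \<alpha> by simp
    show "(x has_vector_derivative v t) (at t)" if "t > t0" for t
      using x_der[of t] at_eq[OF that] that by simp
    show "((\<lambda>t. x t + (t / (\<alpha> - 1)) *\<^sub>R v t) \<longlongrightarrow> l) at_top"
      using w_lim by (simp add: w_def)
  qed

  \<comment> \<open>Minimality of the limit\<close>
  have E_le: "E t \<le> E t0" if "t \<ge> t0" for t
  proof -
    \<comment> \<open>Monotonicity of the energy is read off from \<open>w_incr\<close>, since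
      distances are nonnegative.\<close>
    have "0 \<le> E t0 / k - E t / k"
      by (rule order_trans[OF zero_le_dist w_incr]) (use that in auto)
    then show ?thesis using k by (simp add: field_simps)
  qed
  have ev: "\<forall>\<^sub>F t in at_top. \<Phi> (x t) \<le> \<Phi> z + E t0 / t\<^sup>2"
    using eventually_ge_at_top[of t0]
  proof eventually_elim
    case (elim t)
    have "t\<^sup>2 * (\<Phi> (x t) - \<Phi> z) \<le> E t0"
      using E_ge[of t] E_le[OF elim] by linarith
    then show ?case using elim t0 by (simp add: field_simps)
  qed
  have lim: "((\<lambda>t. \<Phi> (x t)) \<longlongrightarrow> \<Phi> l) at_top"
  proof -
    have "isCont \<Phi> l"
      using grad[of l] has_derivative_continuous by (auto simp: gderiv_def)
    then show ?thesis using x_lim by (rule isCont_tendsto_compose)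
  qed
  have bound_lim: "((\<lambda>t. \<Phi> z + E t0 / t\<^sup>2) \<longlongrightarrow> \<Phi> z + 0) at_top"
    by (intro tendsto_add tendsto_const tendsto_divide_0[OF tendsto_const]
        filterlim_at_top_imp_at_infinity filterlim_pow_at_top filterlim_ident) auto
  \<comment> \<open>The excess over the minimum is at most \<open>E t0 / t\<^sup>2\<close>, which
    vanishes in the limit, while continuity of \<open>\<Phi>\<close> identifies the limit of the
    values.\<close>
  have "\<Phi> l \<le> \<Phi> z"
    using tendsto_le[OF trivial_limit_at_top_linorder bound_lim lim ev] by simp
  then have "l \<in> argmin_set \<Phi>"
    using order_trans[OF _ z_min] by (simp add: argmin_set_def)
  with x_lim integral show ?thesis by blast
qed

end
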